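(* Let $\mathbb{F}$ be a field, let $f\colon S\to T$ be a morphism of monoids, let $A$ be an $S$-graded $\mathbb{F}$-algebra and let $B$ be a $T$-graded $\mathbb{F}$-algebra. Suppose that $\phi\colon A\to B$ is a morphism of algebras compatible with $f$, that is, $\phi(A_s)\subseteq B_{f(s)}$ for all $s\in S$. Then for any cocycle $\mu\in Z^2(T,\mathbb{F}^\times)$, the map $$\phi'\colon A_{\mu^f}\to B_\mu,$$ which coincides with $\phi$ on the underlying vector spaces of $A_{\mu^f}$ and $B_\mu$ (that is, $\phi'(a')=(\phi(a))'$ for all $a\in A$), is a morphism of algebras.
   Context: For a monoid $S$ with identity $e$, a cocycle $\mu\in Z^2(S,\mathbb{F}^\times)$ is a map $\mu\colon S\times S\to\mathbb{F}^\times$ with $\mu(x,yz)\mu(y,z)=\mu(x,y)\mu(xy,z)$ and $\mu(x,e)=\mu(e,x)=1$ for all $x,y,z\in S$. An $S$-graded $\mathbb{F}$-algebra is a unital associative algebra $A=\bigoplus_{s\in S}A_s$ with $A_sA_t\subseteq A_{st}$ for all $s,t\in S$ and $1_A\in A_e$. The twist $A_\mu$ of $A$ by $\mu\in Z^2(S,\mathbb{F}^\times)$ is a copy of the graded vector space $A$, with graded vector space isomorphism $a\mapsto a'$ from $A$ to $A_\mu$, and with the product given on homogeneous elements $a\in A_x$, $b\in A_y$ by $a'*b'=\mu(x,y)(ab)'$, extended linearly; it is an $S$-graded algebra with identity $1_A'$. For a morphism of monoids $f\colon S\to T$ and a cocycle $\mu$ on $T$, the pullback $\mu^f$ is the cocycle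 on $S$ defined by $\mu^f(s,s')=\mu(f(s),f(s'))$. *)

theory Defs
  imports "HOL-Algebra.Module" "HOL-Library.FuncSet"
begin

(* HOL-Algebra's locale "algebra" is restricted to commutative algebras. *)

locale unital_algebra = module F A + F: field F + A: ring A
  for F :: "('k, 'm) ring_scheme" and A :: "('k, 'a) module" +
  assumes smult_mult_left:
      "\<lbrakk>c \<in> carrier F; a \<in> carrier A; b \<in> carrier A\<rbrakk> \<Longrightarrow>
       (c \<odot>\<^bsub>A\<^esub> a) \<otimes>\<^bsub>A\<^esub> b = c \<odot>\<^bsub>A\<^esub> (a \<otimes>\<^bsub>A\<^esub> b)"
    and smult_mult_right:
      "\<lbrakk>c \<in> carrier F; a \<in> carrier A; b \<in> carrier A\<rbrakk> \<Longrightarrow>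
       a \<otimes>\<^bsub>A\<^esub> (c \<odot>\<^bsub>A\<^esub> b) = c \<odot>\<^bsub>A\<^esub> (a \<otimes>\<^bsub>A\<^esub> b)"

(* ring_hom includes preservation of the identity element. *)

locale algebra_morphism =
  source: unital_algebra F A + target: unital_algebra F B
  for F :: "('k, 'm) ring_scheme" and A :: "('k, 'a) module" and B :: "('k, 'b) module" +
  fixes h :: "'a \<Rightarrow> 'b"
  assumes ring_hom: "h \<in> ring_hom A B"
    and smult: "\<lbrakk>c \<in> carrier F; a \<in> carrier A\<rbrakk> \<Longrightarrow> h (c \<odot>\<^bsub>A\<^esub> a) = c \<odot>\<^bsub>B\<^esub> h a"

definition monoid_morphism ::
  "('s, 'm) monoid_scheme \<Rightarrow> ('t, 'n) monoid_scheme \<Rightarrow> ('s \<Rightarrow> 't) \<Rightarrow> bool"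
  where "monoid_morphism S T f \<longleftrightarrow>
    monoid S \<and> monoid T \<and> f \<in> hom S T \<and> f \<one>\<^bsub>S\<^esub> = \<one>\<^bsub>T\<^esub>"

definition graded_support ::
  "('s, 'm) monoid_scheme \<Rightarrow> ('k, 'a) module \<Rightarrow> ('s \<Rightarrow> 'a) \<Rightarrow> 's set"
  where "graded_support S A c = {s \<in> carrier S. c s \<noteq> \<zero>\<^bsub>A\<^esub>}"

(* Families are extensional on the carrier of S, so that "the" decomposition of an element
   can be unique as a HOL function. *)

definition is_graded_decomposition ::
  "('s, 'm) monoid_scheme \<Rightarrow> ('k, 'a) module \<Rightarrow> ('s \<Rightarrow> 'a set) \<Rightarrow> 'a \<Rightarrow> ('s \<Rightarrow> 'a) \<Rightarrow> bool"
  where "is_graded_decomposition S A G a c \<longleftrightarrow>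
    c \<in> (\<Pi>\<^sub>E s\<in>carrier S. G s) \<and> finite (graded_support S A c) \<and>
    a = (\<Oplus>\<^bsub>A\<^esub> s \<in> graded_support S A c. c s)"

definition homogeneous_components ::
  "('s, 'm) monoid_scheme \<Rightarrow> ('k, 'a) module \<Rightarrow> ('s \<Rightarrow> 'a set) \<Rightarrow> 'a \<Rightarrow> 's \<Rightarrow> 'a"
  where "homogeneous_components S A G a = (THE c. is_graded_decomposition S A G a c)"

(* G s is the homogeneous component A_s; some of the G s may be zero. *)

locale graded_algebra = S: monoid S + unital_algebra F A
  for F :: "('k, 'm) ring_scheme" and S :: "('s, 'n) monoid_scheme" and A :: "('k, 'a) module" +
  fixes G :: "'s \<Rightarrow> 'a set"
  assumes subspace: "s \<in> carrier S \<Longrightarrow> submodule (G s) F A"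
    and direct_sum: "a \<in> carrier A \<Longrightarrow> \<exists>!c. is_graded_decomposition S A G a c"
    and mult_graded: "\<lbrakk>s \<in> carrier S; t \<in> carrier S; a \<in> G s; b \<in> G t\<rbrakk> \<Longrightarrow>
      a \<otimes>\<^bsub>A\<^esub> b \<in> G (s \<otimes>\<^bsub>S\<^esub> t)"
    and one_graded: "\<one>\<^bsub>A\<^esub> \<in> G \<one>\<^bsub>S\<^esub>"

definition cocycles ::
  "('s, 'n) monoid_scheme \<Rightarrow> ('k, 'm) ring_scheme \<Rightarrow> ('s \<Rightarrow> 's \<Rightarrow> 'k) set"
  where "cocycles S F = {\<mu>.
    (\<forall>x\<in>carrier S. \<forall>y\<in>carrier S. \<mu> x y \<in> Units F) \<and>
    (\<forall>x\<in>carrier S. \<forall>y\<in>carrier S. \<forall>z\<in>carrier S.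
      \<mu> x (y \<otimes>\<^bsub>S\<^esub> z) \<otimes>\<^bsub>F\<^esub> \<mu> y z = \<mu> x y \<otimes>\<^bsub>F\<^esub> \<mu> (x \<otimes>\<^bsub>S\<^esub> y) z) \<and>
    (\<forall>x\<in>carrier S. \<mu> x \<one>\<^bsub>S\<^esub> = \<one>\<^bsub>F\<^esub> \<and> \<mu> \<one>\<^bsub>S\<^esub> x = \<one>\<^bsub>F\<^esub>)}"

definition pullback :: "('s \<Rightarrow> 't) \<Rightarrow> ('t \<Rightarrow> 't \<Rightarrow> 'k) \<Rightarrow> 's \<Rightarrow> 's \<Rightarrow> 'k"
  where "pullback f \<mu> = (\<lambda>x y. \<mu> (f x) (f y))"

(* The twist is realised on the same underlying graded vector space, so the identification
   of A with its copy is the identity. The product is the bilinear extension, over the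
   homogeneous components of both factors, of the rule a * b = mu(x,y) ab for a in A_x and
   b in A_y; see twist_mult_homogeneous. *)

definition twist ::
  "('s, 'n) monoid_scheme \<Rightarrow> ('k, 'a) module \<Rightarrow> ('s \<Rightarrow> 'a set) \<Rightarrow> ('s \<Rightarrow> 's \<Rightarrow> 'k) \<Rightarrow> ('k, 'a) module"
  where "twist S A G \<mu> = A\<lparr>mult := \<lambda>a b.
    let c = homogeneous_components S A G a; d = homogeneous_components S A G b in
    \<Oplus>\<^bsub>A\<^esub> x \<in> graded_support S A c. \<Oplus>\<^bsub>A\<^esub> y \<in> graded_support S A d.
      \<mu> x y \<odot>\<^bsub>A\<^esub> (c x \<otimes>\<^bsub>A\<^esub> d y)\<rparr>"

context graded_algebra
begin

lemma component_subset: "s \<in> carrier S \<Longrightarrow> G s \<subseteq> carrier A"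
  using submoduleE(1) subspace by blast

lemma zero_component: "s \<in> carrier S \<Longrightarrow> \<zero>\<^bsub>A\<^esub> \<in> G s"
  using subgroup.one_closed[OF submodule.axioms(1)[OF subspace]] by simp

lemma homogeneous_components_homogeneous:
  assumes x: "x \<in> carrier S" and a: "a \<in> G x"
  shows "homogeneous_components S A G a = (\<lambda>s\<in>carrier S. if s = x then a else \<zero>\<^bsub>A\<^esub>)"
    (is "_ = ?c")
proof -
  have aA: "a \<in> carrier A" using component_subset x a by blast
  have supp: "graded_support S A ?c = (if a = \<zero>\<^bsub>A\<^esub> then {} else {x})"
    using x by (auto simp: graded_support_def)
  have "is_graded_decomposition S A G a ?c"
    unfolding is_graded_decomposition_def supp
    using x a aA zero_component by (auto simp: finsum_insert)
  with direct_sum[OF aA] show ?thesis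
    unfolding homogeneous_components_def by (metis (no_types, lifting) the1_equality)
qed

lemma twist_mult_homogeneous:
  assumes x: "x \<in> carrier S" and y: "y \<in> carrier S" and a: "a \<in> G x" and b: "b \<in> G y"
    and \<mu>: "\<mu> x y \<in> carrier F"
  shows "a \<otimes>\<^bsub>twist S A G \<mu>\<^esub> b = \<mu> x y \<odot>\<^bsub>A\<^esub> (a \<otimes>\<^bsub>A\<^esub> b)"
proof -
  have aA: "a \<in> carrier A" and bA: "b \<in> carrier A" using component_subset x y a b by blast+
  have supp: "graded_support S A (\<lambda>s\<in>carrier S. if s = z then d else \<zero>\<^bsub>A\<^esub>) =
      (if d = \<zero>\<^bsub>A\<^esub> then {} else {z})" if "z \<in> carrier S" for z d
    using that by (auto simp: graded_support_def)
  show ?thesis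
    unfolding twist_def
    using aA bA x y \<mu>
    by (simp add: Let_def homogeneous_components_homogeneous[OF x a]
        homogeneous_components_homogeneous[OF y b] supp finsum_insert)
qed

end

end

(* Both the algebra axioms for a twist and the multiplicativity of the map are additive in every
   argument, so it suffices to check them on homogeneous elements. There associativity is the
   cocycle identity and multiplicativity holds because a factor in A_s is mapped to B_(f s). *)

theory Submission
  imports Defs
begin

section \<open>Unchanged fields of a twist, and pullback of cocycles\<close>

lemma twist_simps [simp]:
  "carrier (twist S A G \<mu>) = carrier A"
  "zero (twist S A G \<mu>) = \<zero>\<^bsub>A\<^esub>"
  "one (twist S A G \<mu>) = \<one>\<^bsub>A\<^esub>"
  "add (twist S A G \<mu>) = add A"
  "smult (twist S A G \<mu>) = smult A"
  by (simp_all add: twist_def)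

text \<open>Because \<open>f\<close> preserves products and the identity, each condition on the
  pullback is the same condition on \<open>\<mu>\<close> at image points.\<close>

lemma pullback_cocycle:
  assumes "monoid_morphism S T f" and "\<mu> \<in> cocycles T F"
  shows "pullback f \<mu> \<in> cocycles S F"
proof -
  have mem: "f x \<in> carrier T" if "x \<in> carrier S" for x
    using assms(1) that by (auto simp: monoid_morphism_def hom_def)
  have mult: "f (x \<otimes>\<^bsub>S\<^esub> y) = f x \<otimes>\<^bsub>T\<^esub> f y" if "x \<in> carrier S" "y \<in> carrier S" for x y
    using assms(1) that by (auto simp: monoid_morphism_def hom_def)
  have one: "f \<one>\<^bsub>S\<^esub> = \<one>\<^bsub>T\<^esub>"
    using assms(1) by (simp add: monoid_morphism_def)
  show ?thesis
    using assms(2) by (simp add: cocycles_def pullback_def mem mult one)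
qed

section \<open>Homogeneous components and induction on homogeneous elements\<close>

context graded_algebra
begin

abbreviation component :: "'a \<Rightarrow> 's \<Rightarrow> 'a"
  where "component \<equiv> homogeneous_components S A G"

abbreviation support :: "'a \<Rightarrow> 's set"
  where "support a \<equiv> graded_support S A (component a)"

lemma component_decomposition:
  assumes "a \<in> carrier A"
  shows "is_graded_decomposition S A G a (component a)"
  unfolding homogeneous_components_def by (rule theI'[OF direct_sum[OF assms]])

lemma component_in:
  assumes "a \<in> carrier A" "s \<in> carrier S"
  shows "component a s \<in> G s"
  using component_decomposition[OF assms(1)] assms(2)
  unfolding is_graded_decomposition_def by auto

lemma component_closed:
  assumes "a \<in> carrier A" "s \<in> carrier S"
  shows "component a s \<in> carrier A"
  using component_in[OF assms] component_subset assms(2) by blast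

lemma finite_support:
  assumes "a \<in> carrier A"
  shows "finite (support a)"
  using component_decomposition[OF assms] unfolding is_graded_decomposition_def by blast

lemma support_subset: "support a \<subseteq> carrier S"
  by (auto simp: graded_support_def)

lemma component_outside_support:
  "s \<in> carrier S \<Longrightarrow> s \<notin> support a \<Longrightarrow> component a s = \<zero>\<^bsub>A\<^esub>"
  by (auto simp: graded_support_def)

text \<open>Components outside the support vanish, so enlarging the index set adds only zeros. This
  lets the decompositions of several elements run over a common finite set.\<close>

lemma sum_components:
  assumes "a \<in> carrier A" "finite U" "support a \<subseteq> U" "U \<subseteq> carrier S"
  shows "(\<Oplus>\<^bsub>A\<^esub> s \<in> U. component a s) = a"
proof -
  have "a = (\<Oplus>\<^bsub>A\<^esub> s \<in> support a. component a s)"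
    using component_decomposition[OF assms(1)] unfolding is_graded_decomposition_def by blast
  also have "\<dots> = (\<Oplus>\<^bsub>A\<^esub> s \<in> U. component a s)"
    using assms component_closed[OF assms(1)] component_outside_support
    by (intro M.add.finprod_mono_neutral_cong_left) auto
  finally show ?thesis ..
qed

text \<open>Uniqueness in \<open>direct_sum\<close> makes any candidate family the right one. The
  set \<open>U\<close> may exceed the support of \<open>c\<close>, so a candidate can be tested
  without first determining where it vanishes.\<close>

lemma component_eqI:
  assumes c: "c \<in> (\<Pi>\<^sub>E s\<in>carrier S. G s)" and U: "finite U" "U \<subseteq> carrier S"
    and outside: "\<And>s. s \<in> carrier S \<Longrightarrow> s \<notin> U \<Longrightarrow> c s = \<zero>\<^bsub>A\<^esub>"
    and a: "a = (\<Oplus>\<^bsub>A\<^esub> s \<in> U. c s)"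
  shows "component a = c"
proof -
  have cA: "c s \<in> carrier A" if "s \<in> carrier S" for s
    using c that component_subset by (auto simp: PiE_def Pi_def)
  have sub: "graded_support S A c \<subseteq> U"
    using outside by (auto simp: graded_support_def)
  have "(\<Oplus>\<^bsub>A\<^esub> s \<in> graded_support S A c. c s) = (\<Oplus>\<^bsub>A\<^esub> s \<in> U. c s)"
    using U sub cA by (intro M.add.finprod_mono_neutral_cong_left) (auto simp: graded_support_def)
  moreover have "a \<in> carrier A"
    unfolding a using U cA by (intro M.finsum_closed) auto
  ultimately show ?thesis
    using c a finite_subset[OF sub U(1)] direct_sum[of a]
    unfolding homogeneous_components_def
    by (intro the1_equality) (auto simp: is_graded_decomposition_def)
qed

lemma component_add:
  assumes "a \<in> carrier A" "b \<in> carrier A"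
  shows "component (a \<oplus>\<^bsub>A\<^esub> b) = (\<lambda>s\<in>carrier S. component a s \<oplus>\<^bsub>A\<^esub> component b s)"
\<comment> \<open>Cancellation can make the support of the sum smaller than this union, which
  \<open>component_eqI\<close> tolerates.\<close>
proof (rule component_eqI[where U = "support a \<union> support b"])
  let ?U = "support a \<union> support b"
  show "(\<lambda>s\<in>carrier S. component a s \<oplus>\<^bsub>A\<^esub> component b s) \<in> (\<Pi>\<^sub>E s\<in>carrier S. G s)"
    using component_in[OF assms(1)] component_in[OF assms(2)] submoduleE(5)[OF subspace]
    by auto
  show U: "finite ?U" "?U \<subseteq> carrier S"
    using assms finite_support support_subset by auto
  show "(\<lambda>s\<in>carrier S. component a s \<oplus>\<^bsub>A\<^esub> component b s) s = \<zero>\<^bsub>A\<^esub>"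
    if "s \<in> carrier S" "s \<notin> ?U" for s
    using that by (simp add: component_outside_support)
  have "a \<oplus>\<^bsub>A\<^esub> b = (\<Oplus>\<^bsub>A\<^esub> s \<in> ?U. component a s) \<oplus>\<^bsub>A\<^esub> (\<Oplus>\<^bsub>A\<^esub> s \<in> ?U. component b s)"
    using U assms by (simp add: sum_components)
  also have "\<dots> = (\<Oplus>\<^bsub>A\<^esub> s \<in> ?U. component a s \<oplus>\<^bsub>A\<^esub> component b s)"
    using U component_closed assms by (intro M.finsum_addf[symmetric]) auto
  \<comment> \<open>Decompositions must be extensional on \<open>carrier S\<close>; since
    \<open>?U\<close> lies in \<open>carrier S\<close>, restricting the family leaves the sum
    unchanged.\<close>
  also have "\<dots> = (\<Oplus>\<^bsub>A\<^esub> s \<in> ?U. (\<lambda>s\<in>carrier S. component a s \<oplus>\<^bsub>A\<^esub> component b s) s)"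
    using U component_closed assms by (intro M.finsum_cong') auto
  finally show "a \<oplus>\<^bsub>A\<^esub> b = \<dots>" .
qed

lemma component_smult:
  assumes "k \<in> carrier F" "a \<in> carrier A"
  shows "component (k \<odot>\<^bsub>A\<^esub> a) = (\<lambda>s\<in>carrier S. k \<odot>\<^bsub>A\<^esub> component a s)"
proof (rule component_eqI[where U = "support a"])
  let ?U = "support a"
  show "(\<lambda>s\<in>carrier S. k \<odot>\<^bsub>A\<^esub> component a s) \<in> (\<Pi>\<^sub>E s\<in>carrier S. G s)"
    using component_in[OF assms(2)] submoduleE(4)[OF subspace] assms(1) by auto
  show U: "finite ?U" "?U \<subseteq> carrier S"
    using assms finite_support support_subset by auto
  show "(\<lambda>s\<in>carrier S. k \<odot>\<^bsub>A\<^esub> component a s) s = \<zero>\<^bsub>A\<^esub>"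
    if "s \<in> carrier S" "s \<notin> ?U" for s
    using that assms(1) by (simp add: component_outside_support)
  have "k \<odot>\<^bsub>A\<^esub> a = k \<odot>\<^bsub>A\<^esub> (\<Oplus>\<^bsub>A\<^esub> s \<in> ?U. component a s)"
    using U assms by (simp add: sum_components)
  also have "\<dots> = (\<Oplus>\<^bsub>A\<^esub> s \<in> ?U. k \<odot>\<^bsub>A\<^esub> component a s)"
    using U component_closed assms by (intro finsum_smult_ldistr) auto
  also have "\<dots> = (\<Oplus>\<^bsub>A\<^esub> s \<in> ?U. (\<lambda>s\<in>carrier S. k \<odot>\<^bsub>A\<^esub> component a s) s)"
    using U component_closed assms by (intro M.finsum_cong') auto
  finally show "k \<odot>\<^bsub>A\<^esub> a = \<dots>" .
qed

text \<open>Adding one component at a time shows \<open>P\<close> for every finite partial sum of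
  the decomposition of \<open>a\<close>, and the sum over the whole support is \<open>a\<close>. The
  empty sum is covered by \<open>hom\<close>, since zero is homogeneous of identity degree.\<close>

lemma homogeneous_induct [consumes 1, case_names homogeneous add]:
  assumes a: "a \<in> carrier A"
    and hom: "\<And>s g. s \<in> carrier S \<Longrightarrow> g \<in> G s \<Longrightarrow> P g"
    and add: "\<And>u v. u \<in> carrier A \<Longrightarrow> v \<in> carrier A \<Longrightarrow> P u \<Longrightarrow> P v \<Longrightarrow> P (u \<oplus>\<^bsub>A\<^esub> v)"
  shows "P a"
proof -
  have "P (\<Oplus>\<^bsub>A\<^esub> s \<in> U. component a s)" if "finite U" "U \<subseteq> carrier S" for U
    using that
  proof (induction U rule: finite_induct)
    case empty
    show ?case using hom[OF S.one_closed zero_component[OF S.one_closed]] by simp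
  next
    case (insert x U)
    then have "component a \<in> U \<rightarrow> carrier A"
      using component_closed[OF a] by auto
    with insert show ?case
      using component_closed[OF a] component_in[OF a] hom[of x "component a x"]
      by (simp add: M.finsum_insert add)
  qed
  from this[OF finite_support[OF a] support_subset] show ?thesis
    using sum_components[OF a finite_support[OF a] subset_refl support_subset] by simp
qed

section \<open>Linear endomorphisms and sums over components\<close>

definition linear_endo :: "('a \<Rightarrow> 'a) \<Rightarrow> bool"
  where "linear_endo L \<longleftrightarrow> L \<in> carrier A \<rightarrow> carrier A \<and>
    (\<forall>a\<in>carrier A. \<forall>b\<in>carrier A. L (a \<oplus>\<^bsub>A\<^esub> b) = L a \<oplus>\<^bsub>A\<^esub> L b) \<and>
    (\<forall>k\<in>carrier F. \<forall>a\<in>carrier A. L (k \<odot>\<^bsub>A\<^esub> a) = k \<odot>\<^bsub>A\<^esub> L a)"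

lemma linear_endoI:
  assumes "\<And>a. a \<in> carrier A \<Longrightarrow> L a \<in> carrier A"
    and "\<And>a b. a \<in> carrier A \<Longrightarrow> b \<in> carrier A \<Longrightarrow> L (a \<oplus>\<^bsub>A\<^esub> b) = L a \<oplus>\<^bsub>A\<^esub> L b"
    and "\<And>k a. k \<in> carrier F \<Longrightarrow> a \<in> carrier A \<Longrightarrow> L (k \<odot>\<^bsub>A\<^esub> a) = k \<odot>\<^bsub>A\<^esub> L a"
  shows "linear_endo L"
  using assms by (auto simp: linear_endo_def)

lemma linear_endoD:
  assumes "linear_endo L"
  shows linear_endo_closed: "a \<in> carrier A \<Longrightarrow> L a \<in> carrier A"
    and linear_endo_add: "a \<in> carrier A \<Longrightarrow> b \<in> carrier A \<Longrightarrow> L (a \<oplus>\<^bsub>A\<^esub> b) = L a \<oplus>\<^bsub>A\<^esub> L b"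
    and linear_endo_smult: "k \<in> carrier F \<Longrightarrow> a \<in> carrier A \<Longrightarrow> L (k \<odot>\<^bsub>A\<^esub> a) = k \<odot>\<^bsub>A\<^esub> L a"
  using assms by (auto simp: linear_endo_def)

lemma linear_endo_zero:
  assumes "linear_endo L"
  shows "L \<zero>\<^bsub>A\<^esub> = \<zero>\<^bsub>A\<^esub>"
  using linear_endo_smult[OF assms, of "\<zero>\<^bsub>F\<^esub>" "\<zero>\<^bsub>A\<^esub>"] linear_endo_closed[OF assms, of "\<zero>\<^bsub>A\<^esub>"]
  by (simp add: smult_l_null)

text \<open>With \<open>k\<close> a cocycle value and \<open>c\<close> a component of the fixed
  right factor, such maps are the summands of the twisted product as its left factor varies.
  Commutativity of \<open>F\<close> lets other scalars pass \<open>k\<close>.\<close>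

lemma linear_endo_smult_mult_right:
  assumes "k \<in> carrier F" "c \<in> carrier A"
  shows "linear_endo (\<lambda>u. k \<odot>\<^bsub>A\<^esub> (u \<otimes>\<^bsub>A\<^esub> c))"
  using assms
  by (intro linear_endoI)
    (simp_all add: A.l_distr smult_r_distr smult_mult_left smult_assoc1[symmetric] R.m_comm)

lemma linear_endo_smult_mult_left:
  assumes "k \<in> carrier F" "c \<in> carrier A"
  shows "linear_endo (\<lambda>u. k \<odot>\<^bsub>A\<^esub> (c \<otimes>\<^bsub>A\<^esub> u))"
  using assms
  by (intro linear_endoI)
    (simp_all add: A.r_distr smult_r_distr smult_mult_right smult_assoc1[symmetric] R.m_comm)

lemma linear_endo_finsum:
  assumes U: "finite U" and L: "\<And>x. x \<in> U \<Longrightarrow> linear_endo (L x)"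
  shows "linear_endo (\<lambda>a. \<Oplus>\<^bsub>A\<^esub> x \<in> U. L x a)"
proof (rule linear_endoI)
  have fn: "(\<lambda>x. L x a) \<in> U \<rightarrow> carrier A" if "a \<in> carrier A" for a
    using that L linear_endo_closed by blast
  show "(\<Oplus>\<^bsub>A\<^esub> x \<in> U. L x a) \<in> carrier A" if "a \<in> carrier A" for a
    using fn[OF that] by (rule M.finsum_closed)
  show "(\<Oplus>\<^bsub>A\<^esub> x \<in> U. L x (a \<oplus>\<^bsub>A\<^esub> b)) = (\<Oplus>\<^bsub>A\<^esub> x \<in> U. L x a) \<oplus>\<^bsub>A\<^esub> (\<Oplus>\<^bsub>A\<^esub> x \<in> U. L x b)"
    if ab: "a \<in> carrier A" "b \<in> carrier A" for a b
  proof -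
    have "(\<Oplus>\<^bsub>A\<^esub> x \<in> U. L x (a \<oplus>\<^bsub>A\<^esub> b)) = (\<Oplus>\<^bsub>A\<^esub> x \<in> U. L x a \<oplus>\<^bsub>A\<^esub> L x b)"
      using fn ab L linear_endo_add by (intro M.finsum_cong') auto
    then show ?thesis using M.finsum_addf[OF fn[OF ab(1)] fn[OF ab(2)]] by simp
  qed
  show "(\<Oplus>\<^bsub>A\<^esub> x \<in> U. L x (k \<odot>\<^bsub>A\<^esub> a)) = k \<odot>\<^bsub>A\<^esub> (\<Oplus>\<^bsub>A\<^esub> x \<in> U. L x a)"
    if ka: "k \<in> carrier F" "a \<in> carrier A" for k a
  proof -
    have "(\<Oplus>\<^bsub>A\<^esub> x \<in> U. L x (k \<odot>\<^bsub>A\<^esub> a)) = (\<Oplus>\<^bsub>A\<^esub> x \<in> U. k \<odot>\<^bsub>A\<^esub> L x a)"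
      using fn ka L linear_endo_smult by (intro M.finsum_cong') auto
    then show ?thesis using finsum_smult_ldistr[OF U ka(1) fn[OF ka(2)]] by simp
  qed
qed

text \<open>The difficulty is that the index set depends on \<open>a\<close>. Since each
  \<open>L x\<close> sends zero to zero, the sum can be taken over any larger finite set of degrees.
  Over a set common to all elements involved, linearity follows from that of the components and of
  each \<open>L x\<close>.\<close>

lemma linear_endo_sum_components:
  assumes L: "\<And>x. x \<in> carrier S \<Longrightarrow> linear_endo (L x)"
  shows "linear_endo (\<lambda>a. \<Oplus>\<^bsub>A\<^esub> x \<in> support a. L x (component a x))"
proof (rule linear_endoI)
  let ?L = "\<lambda>a. \<Oplus>\<^bsub>A\<^esub> x \<in> support a. L x (component a x)"
  have cl: "L x a \<in> carrier A" if "x \<in> carrier S" "a \<in> carrier A" for x a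
    using linear_endo_closed[OF L] that by blast
  have enlarge: "?L a = (\<Oplus>\<^bsub>A\<^esub> x \<in> U. L x (component a x))"
    if "a \<in> carrier A" "finite U" "support a \<subseteq> U" "U \<subseteq> carrier S" for a U
    using that cl component_closed linear_endo_zero[OF L] component_outside_support
    by (intro M.add.finprod_mono_neutral_cong_left) (auto simp: subset_iff)
  show "?L a \<in> carrier A" if "a \<in> carrier A" for a
    using that support_subset cl component_closed by (intro M.finsum_closed) blast
  show "?L (a \<oplus>\<^bsub>A\<^esub> b) = ?L a \<oplus>\<^bsub>A\<^esub> ?L b" if ab: "a \<in> carrier A" "b \<in> carrier A" for a b
  proof -
    \<comment> \<open>Including the support of the sum makes \<open>enlarge\<close> apply to all
      three elements without comparing their supports.\<close>
    let ?U = "support a \<union> support b \<union> support (a \<oplus>\<^bsub>A\<^esub> b)"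
    have U: "finite ?U" "?U \<subseteq> carrier S"
      using ab finite_support support_subset by auto
    have fn: "(\<lambda>x. L x (component d x)) \<in> ?U \<rightarrow> carrier A" if "d \<in> carrier A" for d
      using U(2) that cl component_closed by blast
    have "?L (a \<oplus>\<^bsub>A\<^esub> b) = (\<Oplus>\<^bsub>A\<^esub> x \<in> ?U. L x (component (a \<oplus>\<^bsub>A\<^esub> b) x))"
      using U ab by (intro enlarge) auto
    also have "\<dots> = (\<Oplus>\<^bsub>A\<^esub> x \<in> ?U. L x (component a x) \<oplus>\<^bsub>A\<^esub> L x (component b x))"
    proof (rule M.finsum_cong'[OF refl])
      show "(\<lambda>x. L x (component a x) \<oplus>\<^bsub>A\<^esub> L x (component b x)) \<in> ?U \<rightarrow> carrier A"
        using fn ab by blast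
      show "L x (component (a \<oplus>\<^bsub>A\<^esub> b) x) = L x (component a x) \<oplus>\<^bsub>A\<^esub> L x (component b x)"
        if "x \<in> ?U" for x
      proof -
        have "x \<in> carrier S" using that U(2) by blast
        then show ?thesis
          using ab component_closed linear_endo_add[OF L] by (simp add: component_add)
      qed
    qed
    also have "\<dots> = (\<Oplus>\<^bsub>A\<^esub> x \<in> ?U. L x (component a x)) \<oplus>\<^bsub>A\<^esub> (\<Oplus>\<^bsub>A\<^esub> x \<in> ?U. L x (component b x))"
      using fn ab by (intro M.finsum_addf)
    also have "\<dots> = ?L a \<oplus>\<^bsub>A\<^esub> ?L b"
      using enlarge[OF ab(1) U(1) _ U(2)] enlarge[OF ab(2) U(1) _ U(2)]
      by (metis (no_types, lifting) Un_upper1 Un_upper2 sup.coboundedI1)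
    finally show ?thesis .
  qed
  show "?L (k \<odot>\<^bsub>A\<^esub> a) = k \<odot>\<^bsub>A\<^esub> ?L a" if ka: "k \<in> carrier F" "a \<in> carrier A" for k a
  proof -
    let ?U = "support a"
    have U: "finite ?U" "?U \<subseteq> carrier S"
      using ka finite_support support_subset by auto
    have fn: "(\<lambda>x. L x (component a x)) \<in> ?U \<rightarrow> carrier A"
      using U(2) ka cl component_closed by blast
    \<comment> \<open>Scaling cannot create new nonzero components, though it can kill them all when
      \<open>k\<close> is zero; hence the support of \<open>a\<close> serves both elements.\<close>
    have "support (k \<odot>\<^bsub>A\<^esub> a) \<subseteq> ?U"
      using ka by (auto simp: graded_support_def component_smult)
    then have "?L (k \<odot>\<^bsub>A\<^esub> a) = (\<Oplus>\<^bsub>A\<^esub> x \<in> ?U. L x (component (k \<odot>\<^bsub>A\<^esub> a) x))"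
      using U ka by (intro enlarge) auto
    also have "\<dots> = (\<Oplus>\<^bsub>A\<^esub> x \<in> ?U. k \<odot>\<^bsub>A\<^esub> L x (component a x))"
    proof (rule M.finsum_cong'[OF refl])
      show "(\<lambda>x. k \<odot>\<^bsub>A\<^esub> L x (component a x)) \<in> ?U \<rightarrow> carrier A"
        using fn ka by blast
      show "L x (component (k \<odot>\<^bsub>A\<^esub> a) x) = k \<odot>\<^bsub>A\<^esub> L x (component a x)" if "x \<in> ?U" for x
      proof -
        have "x \<in> carrier S" using that U(2) by blast
        then show ?thesis
          using ka component_closed linear_endo_smult[OF L] by (simp add: component_smult)
      qed
    qed
    also have "\<dots> = k \<odot>\<^bsub>A\<^esub> ?L a"
      using finsum_smult_ldistr[OF U(1) ka(1) fn] by simp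
    finally show ?thesis .
  qed
qed

end

section \<open>The twist by a cocycle is a unital algebra\<close>

locale cocycle_twist = graded_algebra F S A G
  for F :: "('k, 'm) ring_scheme" and S :: "('s, 'n) monoid_scheme"
    and A :: "('k, 'a) module" and G :: "'s \<Rightarrow> 'a set" +
  fixes \<mu> :: "'s \<Rightarrow> 's \<Rightarrow> 'k"
  assumes cocycle: "\<mu> \<in> cocycles S F"
begin

abbreviation twist_mult :: "'a \<Rightarrow> 'a \<Rightarrow> 'a"  (infixl "\<star>" 70)
  where "a \<star> b \<equiv> a \<otimes>\<^bsub>twist S A G \<mu>\<^esub> b"

lemma cocycle_closed: "x \<in> carrier S \<Longrightarrow> y \<in> carrier S \<Longrightarrow> \<mu> x y \<in> carrier F"
  using cocycle by (auto simp: cocycles_def)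

lemma twist_mult_eq:
  "a \<star> b = (\<Oplus>\<^bsub>A\<^esub> x \<in> support a. \<Oplus>\<^bsub>A\<^esub> y \<in> support b.
    \<mu> x y \<odot>\<^bsub>A\<^esub> (component a x \<otimes>\<^bsub>A\<^esub> component b y))"
  by (simp add: twist_def Let_def)

text \<open>Here the varying factor controls the outer sum, while the inner sum runs over the fixed
  finite support of \<open>c\<close>. Linearity delivers closure, distributivity and compatibility
  with scalars at once.\<close>

lemma linear_twist_mult_right:
  assumes "c \<in> carrier A"
  shows "linear_endo (\<lambda>a. a \<star> c)"
  unfolding twist_mult_eq
  using assms support_subset
  by (intro linear_endo_sum_components linear_endo_finsum linear_endo_smult_mult_right
      finite_support cocycle_closed component_closed) blast+

text \<open>The nesting is now reversed: the outer sum is fixed and finite, and the varying factor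
  controls the inner one.\<close>

lemma linear_twist_mult_left:
  assumes "c \<in> carrier A"
  shows "linear_endo (\<lambda>a. c \<star> a)"
  unfolding twist_mult_eq
  using assms support_subset
  by (intro linear_endo_finsum linear_endo_sum_components linear_endo_smult_mult_left
      finite_support cocycle_closed component_closed) blast+

lemmas twist_mult_closed = linear_endo_closed[OF linear_twist_mult_right]
lemmas twist_mult_add_left = linear_endo_add[OF linear_twist_mult_right]
lemmas twist_mult_add_right = linear_endo_add[OF linear_twist_mult_left]

lemma twist_mult_homogeneous':
  assumes "x \<in> carrier S" "y \<in> carrier S" "a \<in> G x" "b \<in> G y"
  shows "a \<star> b = \<mu> x y \<odot>\<^bsub>A\<^esub> (a \<otimes>\<^bsub>A\<^esub> b)"
  using assms cocycle_closed by (simp add: twist_mult_homogeneous)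

text \<open>This allows the homogeneous product rule to be applied a second time in a nested
  product, with the inner product in degree \<open>x \<otimes> y\<close>.\<close>

lemma twist_mult_graded:
  assumes "x \<in> carrier S" "y \<in> carrier S" "a \<in> G x" "b \<in> G y"
  shows "a \<star> b \<in> G (x \<otimes>\<^bsub>S\<^esub> y)"
  using assms cocycle_closed submoduleE(4)[OF subspace] mult_graded
  by (simp add: twist_mult_homogeneous')

text \<open>Both bracketings are scalar multiples of the same untwisted product of \<open>a\<close>,
  \<open>b\<close> and \<open>c\<close>, and their scalars are the two sides of the cocycle
  identity.\<close>

lemma twist_mult_assoc_homogeneous:
  assumes xyz: "x \<in> carrier S" "y \<in> carrier S" "z \<in> carrier S"
    and abc: "a \<in> G x" "b \<in> G y" "c \<in> G z"
  shows "a \<star> b \<star> c = a \<star> (b \<star> c)"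
proof -
  have A: "a \<in> carrier A" "b \<in> carrier A" "c \<in> carrier A"
    using xyz abc component_subset by blast+
  have "a \<star> b \<star> c = (\<mu> x y \<otimes>\<^bsub>F\<^esub> \<mu> (x \<otimes>\<^bsub>S\<^esub> y) z) \<odot>\<^bsub>A\<^esub> (a \<otimes>\<^bsub>A\<^esub> b \<otimes>\<^bsub>A\<^esub> c)"
    using xyz abc A cocycle_closed twist_mult_graded[OF xyz(1,2) abc(1,2)]
    by (simp add: twist_mult_homogeneous'[of "x \<otimes>\<^bsub>S\<^esub> y" z] twist_mult_homogeneous'[of x y]
        smult_mult_left smult_assoc1[symmetric] R.m_comm)
  also have "\<mu> x y \<otimes>\<^bsub>F\<^esub> \<mu> (x \<otimes>\<^bsub>S\<^esub> y) z = \<mu> x (y \<otimes>\<^bsub>S\<^esub> z) \<otimes>\<^bsub>F\<^esub> \<mu> y z"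
    using cocycle xyz by (simp add: cocycles_def)
  also have "(\<mu> x (y \<otimes>\<^bsub>S\<^esub> z) \<otimes>\<^bsub>F\<^esub> \<mu> y z) \<odot>\<^bsub>A\<^esub> (a \<otimes>\<^bsub>A\<^esub> b \<otimes>\<^bsub>A\<^esub> c) = a \<star> (b \<star> c)"
    using xyz abc A cocycle_closed twist_mult_graded[OF xyz(2,3) abc(2,3)]
    by (simp add: twist_mult_homogeneous'[of x "y \<otimes>\<^bsub>S\<^esub> z"] twist_mult_homogeneous'[of y z]
        smult_mult_right smult_assoc1 A.m_assoc)
  finally show ?thesis .
qed

text \<open>Three nested homogeneous inductions reduce one factor at a time: \<open>b\<close> is
  split only once \<open>a\<close> is homogeneous, and \<open>c\<close> only once both are. Each
  additive case uses biadditivity of the twisted product.\<close>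

lemma twist_mult_assoc:
  assumes "a \<in> carrier A" and b: "b \<in> carrier A" and c: "c \<in> carrier A"
  shows "a \<star> b \<star> c = a \<star> (b \<star> c)"
  using assms(1)
proof (induction a rule: homogeneous_induct)
  case (add u v)
  then show ?case using b c by (simp add: twist_mult_add_left twist_mult_closed)
next
  case (homogeneous x a)
  then have a: "a \<in> carrier A" using component_subset by blast
  from b show ?case
  proof (induction b rule: homogeneous_induct)
    case (add u v)
    then show ?case
      using a c by (simp add: twist_mult_add_left twist_mult_add_right twist_mult_closed)
  next
    case (homogeneous y b)
    then have b: "b \<in> carrier A" using component_subset by blast
    from c show ?case
    proof (induction c rule: homogeneous_induct)
      case (add u v)
      then show ?case using a b by (simp add: twist_mult_add_right twist_mult_closed)
    next
      case (homogeneous z c)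
      then show ?case
        using \<open>x \<in> carrier S\<close> \<open>a \<in> G x\<close> \<open>y \<in> carrier S\<close> \<open>b \<in> G y\<close>
        by (intro twist_mult_assoc_homogeneous)
    qed
  qed
qed

text \<open>The unit has identity degree, so on a homogeneous element the scalar is a value of
  \<open>\<mu>\<close> with one argument the identity, and normalisation makes it 1.\<close>

lemma twist_mult_one:
  assumes "a \<in> carrier A"
  shows twist_mult_one_left: "\<one>\<^bsub>A\<^esub> \<star> a = a"
    and twist_mult_one_right: "a \<star> \<one>\<^bsub>A\<^esub> = a"
proof -
  have "\<one>\<^bsub>A\<^esub> \<star> a = a \<and> a \<star> \<one>\<^bsub>A\<^esub> = a"
    using assms
  proof (induction a rule: homogeneous_induct)
    case (homogeneous x a)
    then have "a \<in> carrier A" using component_subset by blast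
    moreover have "\<mu> x \<one>\<^bsub>S\<^esub> = \<one>\<^bsub>F\<^esub>" "\<mu> \<one>\<^bsub>S\<^esub> x = \<one>\<^bsub>F\<^esub>"
      using cocycle homogeneous(1) by (auto simp: cocycles_def)
    ultimately show ?case
      using homogeneous one_graded
      by (simp add: twist_mult_homogeneous'[of "\<one>\<^bsub>S\<^esub>" x] twist_mult_homogeneous'[of x "\<one>\<^bsub>S\<^esub>"])
  qed (simp add: twist_mult_add_left twist_mult_add_right)
  then show "\<one>\<^bsub>A\<^esub> \<star> a = a" "a \<star> \<one>\<^bsub>A\<^esub> = a" by auto
qed

lemma ring_twist: "ring (twist S A G \<mu>)"
proof (rule ringI)
  show "abelian_group (twist S A G \<mu>)"
    using M.a_inv_closed
    by (intro abelian_groupI) (auto simp: M.a_ac intro: M.l_neg)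
  show "monoid (twist S A G \<mu>)"
    by (intro monoidI)
      (simp_all add: twist_mult_closed twist_mult_assoc twist_mult_one_left twist_mult_one_right)
qed (simp_all add: twist_mult_add_left twist_mult_add_right)

lemma unital_algebra_twist: "unital_algebra F (twist S A G \<mu>)"
proof -
  interpret twist: ring "twist S A G \<mu>" by (rule ring_twist)
  have "module F (twist S A G \<mu>)"
    by (intro moduleI R.is_cring twist.is_abelian_group)
      (simp_all add: smult_l_distr smult_r_distr smult_assoc1)
  \<comment> \<open>The two axioms relating scalars to products are the scalar parts of linearity in
    the left and in the right factor.\<close>
  then show ?thesis
    using linear_endo_smult[OF linear_twist_mult_right] linear_endo_smult[OF linear_twist_mult_left]
    by (intro unital_algebra.intro unital_algebra_axioms.intro ring_twist F.field_axioms) simp_all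
qed

end

section \<open>Multiplicativity of the map between twists\<close>

text \<open>If \<open>f\<close> is not injective, one component of \<open>\<phi> a\<close> may
  collect the images of several components of \<open>a\<close>, so the double sums defining the two
  products need not match term by term. Nested homogeneous induction on \<open>a\<close> and
  \<open>b\<close> avoids comparing them.\<close>

lemma twist_mult_morphism:
  assumes "cocycle_twist F S A A_gr (pullback f \<mu>)" and "cocycle_twist F T B B_gr \<mu>"
    and "algebra_morphism F A B \<phi>"
    and f: "f \<in> carrier S \<rightarrow> carrier T"
    and compatible: "\<And>s. s \<in> carrier S \<Longrightarrow> \<phi> ` A_gr s \<subseteq> B_gr (f s)"
    and "a \<in> carrier A" and b: "b \<in> carrier A"
  shows "\<phi> (a \<otimes>\<^bsub>twist S A A_gr (pullback f \<mu>)\<^esub> b) = \<phi> a \<otimes>\<^bsub>twist T B B_gr \<mu>\<^esub> \<phi> b"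
proof -
  interpret source: cocycle_twist F S A A_gr "pullback f \<mu>" by fact
  interpret target: cocycle_twist F T B B_gr \<mu> by fact
  interpret morphism: algebra_morphism F A B \<phi> by fact
  note hom = ring_hom_closed[OF morphism.ring_hom] ring_hom_mult[OF morphism.ring_hom]
    ring_hom_add[OF morphism.ring_hom]
  from \<open>a \<in> carrier A\<close> show ?thesis
  proof (induction a rule: source.homogeneous_induct)
    case (add u v)
    then show ?case
      using b by (simp add: hom source.twist_mult_add_left target.twist_mult_add_left
          source.twist_mult_closed)
  next
    case (homogeneous x a)
    then have a: "a \<in> carrier A" using source.component_subset by blast
    from b show ?case
    proof (induction b rule: source.homogeneous_induct)
      case (add u v)
      then show ?case
        using a by (simp add: hom source.twist_mult_add_right target.twist_mult_add_right
            source.twist_mult_closed)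
    next
      case (homogeneous y b)
      then have b: "b \<in> carrier A" using source.component_subset by blast
      have fxy: "f x \<in> carrier T" "f y \<in> carrier T"
        using f homogeneous \<open>x \<in> carrier S\<close> by auto
      \<comment> \<open>Compatibility fixes the degrees in \<open>B\<close>, so the target twist
        scales by \<open>\<mu> (f x) (f y)\<close>. This is exactly the value of the pullback used
        in the source, and \<open>\<phi>\<close> commutes with that scalar.\<close>
      have "\<phi> a \<in> B_gr (f x)" "\<phi> b \<in> B_gr (f y)"
        using compatible homogeneous \<open>x \<in> carrier S\<close> \<open>a \<in> A_gr x\<close> by blast+
      then have "\<phi> a \<otimes>\<^bsub>twist T B B_gr \<mu>\<^esub> \<phi> b = \<mu> (f x) (f y) \<odot>\<^bsub>B\<^esub> (\<phi> a \<otimes>\<^bsub>B\<^esub> \<phi> b)"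
        using fxy by (intro target.twist_mult_homogeneous')
      moreover have "a \<otimes>\<^bsub>twist S A A_gr (pullback f \<mu>)\<^esub> b = \<mu> (f x) (f y) \<odot>\<^bsub>A\<^esub> (a \<otimes>\<^bsub>A\<^esub> b)"
        using homogeneous \<open>x \<in> carrier S\<close> \<open>a \<in> A_gr x\<close>
        by (subst source.twist_mult_homogeneous') (auto simp: pullback_def)
      ultimately show ?case
        using a b fxy target.cocycle_closed by (simp add: hom morphism.smult)
    qed
  qed
qed

theorem lemma3p5:
  fixes F :: "('k, 'm) ring_scheme"
    and S :: "('s, 'n) monoid_scheme" and T :: "('t, 'o) monoid_scheme"
    and A :: "('k, 'a) module" and B :: "('k, 'b) module"
    and A_gr :: "'s \<Rightarrow> 'a set" and B_gr :: "'t \<Rightarrow> 'b set"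
    and f :: "'s \<Rightarrow> 't" and \<phi> :: "'a \<Rightarrow> 'b" and \<mu> :: "'t \<Rightarrow> 't \<Rightarrow> 'k"
  assumes "field F"
    and "monoid_morphism S T f"
    and "graded_algebra F S A A_gr"
    and "graded_algebra F T B B_gr"
    and "algebra_morphism F A B \<phi>"
    and "\<And>s. s \<in> carrier S \<Longrightarrow> \<phi> ` A_gr s \<subseteq> B_gr (f s)"
    and "\<mu> \<in> cocycles T F"
  shows "algebra_morphism F (twist S A A_gr (pullback f \<mu>)) (twist T B B_gr \<mu>) \<phi>"
proof -
  have "cocycle_twist F S A A_gr (pullback f \<mu>)"
    using assms pullback_cocycle
    by (intro cocycle_twist.intro cocycle_twist_axioms.intro)
  then interpret source: cocycle_twist F S A A_gr "pullback f \<mu>" .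
  have "cocycle_twist F T B B_gr \<mu>"
    using assms by (intro cocycle_twist.intro cocycle_twist_axioms.intro)
  then interpret target: cocycle_twist F T B B_gr \<mu> .
  interpret morphism: algebra_morphism F A B \<phi> by fact
  have f: "f \<in> carrier S \<rightarrow> carrier T"
    using assms(2) by (auto simp: monoid_morphism_def hom_def)
  \<comment> \<open>Twisting leaves carriers, addition and units untouched, so only the product
    clause differs from the hypothesis on \<open>\<phi>\<close>.\<close>
  have "\<phi> \<in> ring_hom (twist S A A_gr (pullback f \<mu>)) (twist T B B_gr \<mu>)"
    using morphism.ring_hom
      twist_mult_morphism[OF source.cocycle_twist_axioms target.cocycle_twist_axioms assms(5) f assms(6)]
    by (intro ring_hom_memI) (auto simp: ring_hom_def)
  then show ?thesis
    using morphism.smult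
    by (intro algebra_morphism.intro algebra_morphism_axioms.intro
        source.unital_algebra_twist target.unital_algebra_twist) simp_all
qed

end
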